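(* If a proper ideal $\mathcal I$ on $\omega$ is complemented, then $\mathcal I$ is a statistical ideal.
   Context: An ideal on $\omega$ is a collection of subsets of $\omega$ containing $\emptyset$, closed under subsets and finite unions; every ideal is assumed to contain all finite sets; it is proper if it is not $\mathcal P(\omega)$. $c_{0,\mathcal I}$ is the closed subspace of $\ell_\infty$ of all bounded scalar sequences $(x_n)$ with $\{n:|x_n|\ge\varepsilon\}\in\mathcal I$ for every $\varepsilon>0$. A proper ideal $\mathcal I$ is complemented if $c_{0,\mathcal I}$ is complemented in $\ell_\infty$, i.e. is the range of a bounded linear projection on $\ell_\infty$. A statistical measure is a finitely additive nonnegative measure $\mu$ defined on all subsets of $\omega$ with $\mu(\omega)=1$ and $\mu(\{k\})=0$ for all $k\in\omega$. A statistical ideal is an ideal of the form $\{A\subseteq\omega:\mu(A)=0\}$ for some statistical measure $\mu$. *)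

theory Defs
  imports "HOL-Analysis.Analysis"
begin

definition ideal_on_omega :: "nat set set \<Rightarrow> bool" where
  "ideal_on_omega I \<longleftrightarrow>
     {} \<in> I \<and>
     (\<forall>A B. A \<in> I \<longrightarrow> B \<subseteq> A \<longrightarrow> B \<in> I) \<and>
     (\<forall>A B. A \<in> I \<longrightarrow> B \<in> I \<longrightarrow> A \<union> B \<in> I) \<and>
     (\<forall>F. finite F \<longrightarrow> F \<in> I)"

definition proper_ideal :: "nat set set \<Rightarrow> bool" where
  "proper_ideal I \<longleftrightarrow> ideal_on_omega I \<and> I \<noteq> UNIV"

text \<open>
  The type \<open>nat \<Rightarrow>\<^sub>C 'a\<close> of bounded continuous functions with the supremum norm is the space
  \<open>\<ell>\<^sub>\<infinity>\<close> of bounded \<open>'a\<close>-valued sequences, because \<open>nat\<close> carries the discrete topology.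
  The scalar field \<open>'a\<close> is intended to be \<open>real\<close> or \<open>complex\<close>.
\<close>

definition c0_ideal :: "nat set set \<Rightarrow> (nat \<Rightarrow>\<^sub>C 'a :: real_normed_field) set" where
  "c0_ideal I = {x. \<forall>\<epsilon>>0. {n. norm (apply_bcontfun x n) \<ge> \<epsilon>} \<in> I}"

text \<open>
  \<^const>\<open>bounded_linear\<close> only asks for linearity over the reals. The third conjunct adds homogeneity
  for all scalars in \<open>'a\<close>, formulated pointwise (\<open>y = c \<cdot> x\<close> implies \<open>P y = c \<cdot> P x\<close>) because the
  library has no complex scalar multiplication on bounded continuous functions. It is redundant
  for \<open>'a = real\<close>.
\<close>

definition bounded_projection_onto ::
    "((nat \<Rightarrow>\<^sub>C 'a :: real_normed_field) \<Rightarrow> (nat \<Rightarrow>\<^sub>C 'a)) \<Rightarrow> (nat \<Rightarrow>\<^sub>C 'a) set \<Rightarrow> bool" where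
  "bounded_projection_onto P S \<longleftrightarrow>
     bounded_linear P \<and>
     (\<forall>x. P (P x) = P x) \<and>
     (\<forall>c x y. (\<forall>n. apply_bcontfun y n = c * apply_bcontfun x n) \<longrightarrow>
        (\<forall>n. apply_bcontfun (P y) n = c * apply_bcontfun (P x) n)) \<and>
     range P = S"

definition complemented_ideal :: "'a :: real_normed_field itself \<Rightarrow> nat set set \<Rightarrow> bool" where
  "complemented_ideal _ I \<longleftrightarrow>
     (\<exists>P :: (nat \<Rightarrow>\<^sub>C 'a) \<Rightarrow> (nat \<Rightarrow>\<^sub>C 'a). bounded_projection_onto P (c0_ideal I))"

definition statistical_measure :: "(nat set \<Rightarrow> real) \<Rightarrow> bool" where
  "statistical_measure \<mu> \<longleftrightarrow>
     (\<forall>A. \<mu> A \<ge> 0) \<and>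
     additive UNIV \<mu> \<and>
     \<mu> UNIV = 1 \<and>
     (\<forall>k. \<mu> {k} = 0)"

definition statistical_ideal :: "nat set set \<Rightarrow> bool" where
  "statistical_ideal I \<longleftrightarrow>
     ideal_on_omega I \<and> (\<exists>\<mu>. statistical_measure \<mu> \<and> I = {A. \<mu> A = 0})"

end

theory Submission
  imports Defs
begin

text \<open>
  If \<open>P\<close> is a projection onto \<open>c\<^bsub>0,\<I>\<^esub>\<close>, the coordinates of \<open>x - P x\<close> are countably many bounded
  functionals whose common kernel is \<open>c\<^bsub>0,\<I>\<^esub>\<close>. Evaluated at indicator functions they become bounded
  finitely additive signed measures \<open>\<nu>\<^sub>n\<close>, and \<open>A \<in> \<I>\<close> iff every \<open>\<nu>\<^sub>n\<close> vanishes on all subsets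
  of \<open>A\<close>, that is, iff all the variations of the \<open>\<nu>\<^sub>n\<close> vanish at \<open>A\<close>. A weighted sum of these
  variations, normalised to total mass 1, is the required statistical measure.
\<close>

section \<open>Positive variation of a bounded finitely additive signed measure\<close>

text \<open>This is the positive part in the Jordan decomposition of \<nu>. Boundedness of \<nu>,
  assumed in the context below, keeps the supremum finite.\<close>

definition pos_variation :: "('a set \<Rightarrow> real) \<Rightarrow> 'a set \<Rightarrow> real" where
  "pos_variation \<nu> A = (SUP B\<in>Pow A. \<nu> B)"

context
  fixes \<nu> :: "'a set \<Rightarrow> real"
  assumes add: "additive UNIV \<nu>" and bdd: "bounded (range \<nu>)"
begin

lemma additive_empty: "\<nu> {} = 0"
  using additiveD[OF add, of "{}" "{}"] by simp

lemma pos_variation_upper: "B \<subseteq> A \<Longrightarrow> \<nu> B \<le> pos_variation \<nu> A"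
  unfolding pos_variation_def
  by (rule cSUP_upper) (auto intro: bdd_above_mono[OF bounded_imp_bdd_above[OF bdd]])

lemma pos_variation_least: "(\<And>B. B \<subseteq> A \<Longrightarrow> \<nu> B \<le> c) \<Longrightarrow> pos_variation \<nu> A \<le> c"
  unfolding pos_variation_def by (rule cSUP_least) auto

lemma pos_variation_nonneg: "0 \<le> pos_variation \<nu> A"
  using pos_variation_upper[of "{}" A] by (simp add: additive_empty)

lemma pos_variation_mono: "A \<subseteq> B \<Longrightarrow> pos_variation \<nu> A \<le> pos_variation \<nu> B"
  by (rule pos_variation_least) (auto intro: pos_variation_upper)

text \<open>A subset of a disjoint union \<open>A \<union> B\<close> splits uniquely into a part in
  \<open>A\<close> and a part in \<open>B\<close>, and these parts can be chosen independently.
  Hence the supremum of the sums is the sum of the suprema.\<close>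

lemma additive_pos_variation: "additive UNIV (pos_variation \<nu>)"
  unfolding additive_def
proof (intro ballI impI antisym)
  fix A B :: "'a set"
  assume disj: "A \<inter> B = {}"
  have un: "\<nu> (C \<union> D) = \<nu> C + \<nu> D" if "C \<subseteq> A" "D \<subseteq> B" for C D
    using add that disj unfolding additive_def by blast
  show "pos_variation \<nu> (A \<union> B) \<le> pos_variation \<nu> A + pos_variation \<nu> B"
  proof (rule pos_variation_least)
    fix E assume "E \<subseteq> A \<union> B"
    then have "E = (E \<inter> A) \<union> (E \<inter> B)" by blast
    then have "\<nu> E = \<nu> (E \<inter> A) + \<nu> (E \<inter> B)"
      using un[of "E \<inter> A" "E \<inter> B"] by simp
    then show "\<nu> E \<le> pos_variation \<nu> A + pos_variation \<nu> B"
      by (simp add: add_mono pos_variation_upper)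
  qed
  \<comment> \<open>The two suprema are taken one at a time: first over \<open>C\<close> with
    \<open>D\<close> fixed, then over \<open>D\<close>. Neither has to be attained.\<close>
  have "pos_variation \<nu> A \<le> pos_variation \<nu> (A \<union> B) - \<nu> D" if D: "D \<subseteq> B" for D
  proof (rule pos_variation_least)
    fix C assume C: "C \<subseteq> A"
    then have "\<nu> C + \<nu> D \<le> pos_variation \<nu> (A \<union> B)"
      using D un[OF C D] pos_variation_upper[of "C \<union> D" "A \<union> B"] by auto
    then show "\<nu> C \<le> pos_variation \<nu> (A \<union> B) - \<nu> D" by simp
  qed
  then have "pos_variation \<nu> B \<le> pos_variation \<nu> (A \<union> B) - pos_variation \<nu> A"
    by (intro pos_variation_least) (simp add: algebra_simps)
  then show "pos_variation \<nu> A + pos_variation \<nu> B \<le> pos_variation \<nu> (A \<union> B)" by simp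
qed

end

section \<open>One measure with the common null sets of countably many\<close>

text \<open>In a convergent series of nonnegative terms with positive weights nothing cancels, so
  the sum vanishes at a set only if every term does.\<close>

lemma countable_weighted_sum_additive:
  fixes m :: "nat \<Rightarrow> 'a set \<Rightarrow> real"
  assumes add: "\<And>n. additive UNIV (m n)"
    and nonneg: "\<And>n A. 0 \<le> m n A" and mono: "\<And>n A. m n A \<le> m n UNIV"
  obtains m\<^sub>0 :: "'a set \<Rightarrow> real"
  where "additive UNIV m\<^sub>0" "\<And>A. 0 \<le> m\<^sub>0 A" "\<And>A. m\<^sub>0 A = 0 \<longleftrightarrow> (\<forall>n. m n A = 0)"
proof -
  \<comment> \<open>The total masses \<open>m n UNIV\<close> need not be bounded in
    \<open>n\<close>, so each measure is rescaled to values at most 1 before the geometric weight is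
    applied. The summand 1 in the denominator keeps it positive even when \<open>m n\<close> is
    zero.\<close>
  define t where "t A n = (1/2) ^ n * (m n A / (1 + m n UNIV))" for A n
  have t0: "0 \<le> t A n" for A n
    unfolding t_def using nonneg by (intro mult_nonneg_nonneg divide_nonneg_nonneg add_nonneg_nonneg) auto
  have "m n A / (1 + m n UNIV) \<le> 1" for A n
    using nonneg[of n UNIV] mono[of n A] by (simp add: divide_simps)
  then have "t A n \<le> (1/2) ^ n" for A n
    unfolding t_def by (intro mult_left_le) auto
  then have summable: "summable (t A)" for A
    using t0 by (intro summable_comparison_test'[OF summable_geometric[of "1/2::real"], of 0]) auto
  have "additive UNIV (\<lambda>A. suminf (t A))"
    unfolding additive_def
  proof (intro ballI impI)
    fix A B :: "'a set"
    assume "A \<inter> B = {}"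
    then have "t (A \<union> B) = (\<lambda>n. t A n + t B n)"
      using add unfolding additive_def t_def by (simp add: fun_eq_iff add_divide_distrib distrib_left)
    then show "suminf (t (A \<union> B)) = suminf (t A) + suminf (t B)"
      by (simp add: suminf_add summable)
  qed
  moreover have "0 \<le> suminf (t A)" for A
    by (simp add: suminf_nonneg summable t0)
  moreover have "t A n = 0 \<longleftrightarrow> m n A = 0" for A n
    unfolding t_def using nonneg[of n UNIV] by auto
  then have "suminf (t A) = 0 \<longleftrightarrow> (\<forall>n. m n A = 0)" for A
    by (simp add: suminf_eq_zero_iff summable t0)
  ultimately show thesis by (rule that)
qed

text \<open>
  Closure under negation lets positive variations replace total variations.
\<close>

lemma statistical_measure_of_countable_family:
  fixes M :: "(nat set \<Rightarrow> real) set"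
  assumes "countable M"
    and add: "\<And>\<nu>. \<nu> \<in> M \<Longrightarrow> additive UNIV \<nu>"
    and bdd: "\<And>\<nu>. \<nu> \<in> M \<Longrightarrow> bounded (range \<nu>)"
    and minus: "\<And>\<nu>. \<nu> \<in> M \<Longrightarrow> (\<lambda>A. - \<nu> A) \<in> M"
    and singleton: "\<And>\<nu> k. \<nu> \<in> M \<Longrightarrow> \<nu> {k} = 0"
    and nonzero: "\<exists>\<nu>\<in>M. \<exists>A. \<nu> A \<noteq> 0"
  obtains \<mu> where "statistical_measure \<mu>" "\<And>A. \<mu> A = 0 \<longleftrightarrow> (\<forall>\<nu>\<in>M. \<forall>B\<subseteq>A. \<nu> B = 0)"
proof -
  have "M \<noteq> {}" using nonzero by auto
  \<comment> \<open>The enumeration of \<open>M\<close> may repeat members, for instance when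
    \<open>M\<close> is finite. This only changes the weights in the sum, not its null sets.\<close>
  define m where "m n = pos_variation (from_nat_into M n)" for n
  have in_M: "from_nat_into M n \<in> M" for n
    using \<open>M \<noteq> {}\<close> by (rule from_nat_into)
  obtain m\<^sub>0 :: "nat set \<Rightarrow> real" where m\<^sub>0: "additive UNIV m\<^sub>0" "\<And>A. 0 \<le> m\<^sub>0 A" "\<And>A. m\<^sub>0 A = 0 \<longleftrightarrow> (\<forall>n. m n A = 0)"
  proof (rule countable_weighted_sum_additive[of m])
    note add_m = add[OF in_M] and bdd_m = bdd[OF in_M]
    show "additive UNIV (m n)" "0 \<le> m n A" "m n A \<le> m n UNIV" for n A
      unfolding m_def
      by (rule additive_pos_variation[OF add_m bdd_m] pos_variation_nonneg[OF add_m bdd_m]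
          pos_variation_mono[OF add_m bdd_m subset_UNIV])+
  qed (rule that)
  have "(\<forall>n. m n A = 0) \<longleftrightarrow> (\<forall>\<nu>\<in>M. pos_variation \<nu> A = 0)" for A
  proof
    assume 0: "\<forall>n. m n A = 0"
    show "\<forall>\<nu>\<in>M. pos_variation \<nu> A = 0"
    proof
      fix \<nu> assume "\<nu> \<in> M"
      then obtain n where "from_nat_into M n = \<nu>"
        using from_nat_into_surj[OF \<open>countable M\<close>] by blast
      then show "pos_variation \<nu> A = 0" using 0 by (auto simp: m_def)
    qed
  qed (simp add: m_def in_M)
  moreover have "(\<forall>\<nu>\<in>M. pos_variation \<nu> A = 0) \<longleftrightarrow> (\<forall>\<nu>\<in>M. \<forall>B\<subseteq>A. \<nu> B = 0)" for A
  proof (intro iffI ballI allI impI)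
    fix \<nu> B
    assume 0: "\<forall>\<nu>\<in>M. pos_variation \<nu> A = 0" and \<nu>: "\<nu> \<in> M" and B: "B \<subseteq> A"
    \<comment> \<open>A vanishing positive variation bounds values only from above; the same bound
      for the negated measure, also in \<open>M\<close>, gives equality.\<close>
    have "\<nu>' B \<le> 0" if "\<nu>' \<in> M" for \<nu>'
      using pos_variation_upper[OF add[OF that] bdd[OF that] B] bspec[OF 0 that] by linarith
    from this[OF \<nu>] this[OF minus[OF \<nu>]] show "\<nu> B = 0" by linarith
  next
    fix \<nu>
    assume 0: "\<forall>\<nu>\<in>M. \<forall>B\<subseteq>A. \<nu> B = 0" and \<nu>: "\<nu> \<in> M"
    have "pos_variation \<nu> A \<le> 0"
      using 0 \<nu> by (intro pos_variation_least[OF add[OF \<nu>] bdd[OF \<nu>]]) (metis order_refl)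
    then show "pos_variation \<nu> A = 0"
      using pos_variation_nonneg[OF add[OF \<nu>] bdd[OF \<nu>], of A] by linarith
  qed
  ultimately have null: "m\<^sub>0 A = 0 \<longleftrightarrow> (\<forall>\<nu>\<in>M. \<forall>B\<subseteq>A. \<nu> B = 0)" for A
    using m\<^sub>0(3) by simp
  \<comment> \<open>A set where some member of \<open>M\<close> is nonzero witnesses that the whole
    space is not null, so the division below is legitimate.\<close>
  have "m\<^sub>0 UNIV \<noteq> 0" using null nonzero by blast
  have "m\<^sub>0 {k} = 0" for k
    unfolding null
  proof (intro ballI allI impI)
    fix \<nu> B assume "\<nu> \<in> M" "B \<subseteq> {k}"
    then show "\<nu> B = 0"
      using singleton[of \<nu> k] additive_empty[OF add bdd, of \<nu>] by (auto simp: subset_singleton_iff)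
  qed
  then have "statistical_measure (\<lambda>A. m\<^sub>0 A / m\<^sub>0 UNIV)"
    using m\<^sub>0(1,2) \<open>m\<^sub>0 UNIV \<noteq> 0\<close> unfolding statistical_measure_def additive_def
    by (simp add: add_divide_distrib)
  then show thesis
  proof (rule that)
    show "m\<^sub>0 A / m\<^sub>0 UNIV = 0 \<longleftrightarrow> (\<forall>\<nu>\<in>M. \<forall>B\<subseteq>A. \<nu> B = 0)" for A
      unfolding null[symmetric] using \<open>m\<^sub>0 UNIV \<noteq> 0\<close> by simp
  qed
qed

section \<open>Indicator functions as bounded sequences\<close>

definition ind_bcontfun :: "nat set \<Rightarrow> nat \<Rightarrow>\<^sub>C 'a :: real_normed_field" where
  "ind_bcontfun A = Bcontfun (indicator A)"

lemma apply_ind_bcontfun [simp]: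
  "apply_bcontfun (ind_bcontfun A) = (indicator A :: nat \<Rightarrow> 'a :: real_normed_field)"
proof -
  have "norm (indicator A n :: 'a) \<le> 1" for n
    by (simp add: indicator_def)
  then have "(indicator A :: nat \<Rightarrow> 'a) \<in> bcontfun"
    by (intro bcontfun_normI[where b = 1]) simp_all
  then show ?thesis unfolding ind_bcontfun_def by (rule Bcontfun_inverse)
qed

lemma ind_bcontfun_Un:
  "A \<inter> B = {} \<Longrightarrow> ind_bcontfun (A \<union> B) = ind_bcontfun A + ind_bcontfun B"
  by (rule bcontfun_eqI) (auto simp: indicator_def)

lemma norm_ind_bcontfun_le: "norm (ind_bcontfun A) \<le> 1"
  by (rule norm_bound) (simp add: indicator_def)

text \<open>An indicator takes only the values 0 and 1: the threshold 1 recovers \<open>A\<close>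
  itself, and every positive threshold gives a subset of \<open>A\<close>.\<close>

lemma ind_bcontfun_in_c0_ideal_iff:
  assumes "ideal_on_omega I"
  shows "ind_bcontfun A \<in> (c0_ideal I :: (nat \<Rightarrow>\<^sub>C 'a :: real_normed_field) set) \<longleftrightarrow> A \<in> I"
proof
  assume "ind_bcontfun A \<in> (c0_ideal I :: (nat \<Rightarrow>\<^sub>C 'a) set)"
  then have "{n. norm (indicator A n :: 'a) \<ge> 1} \<in> I"
    unfolding c0_ideal_def by simp
  moreover have "{n. norm (indicator A n :: 'a) \<ge> 1} = A"
    by (auto simp: indicator_def)
  ultimately show "A \<in> I" by simp
next
  assume "A \<in> I"
  moreover have "{n. norm (indicator A n :: 'a) \<ge> \<epsilon>} \<subseteq> A" if "\<epsilon> > 0" for \<epsilon>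
    using that by (auto simp: indicator_def split: if_splits)
  ultimately show "ind_bcontfun A \<in> (c0_ideal I :: (nat \<Rightarrow>\<^sub>C 'a) set)"
    using assms unfolding c0_ideal_def ideal_on_omega_def by simp
qed

section \<open>From a projection to a statistical measure\<close>

text \<open>The sort \<open>euclidean_space\<close> treats real and complex scalars together: inner
  products with basis vectors turn scalar-valued set functions into finitely many real ones.\<close>

lemma complemented_imp_statistical:
  assumes proper: "proper_ideal I"
    and compl: "complemented_ideal TYPE('a :: {real_normed_field, euclidean_space}) I"
  shows "statistical_ideal I"
proof -
  have ideal: "ideal_on_omega I" and "I \<noteq> UNIV"
    using proper by (auto simp: proper_ideal_def)
  obtain P :: "(nat \<Rightarrow>\<^sub>C 'a) \<Rightarrow> (nat \<Rightarrow>\<^sub>C 'a)"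
    where P: "bounded_linear P" "\<And>x. P (P x) = P x" "range P = c0_ideal I"
    using compl by (auto simp: complemented_ideal_def bounded_projection_onto_def)
  interpret P: bounded_linear P by fact
  define Q where "Q A = ind_bcontfun A - P (ind_bcontfun A)" for A
  \<comment> \<open>Since \<open>P\<close> is idempotent, its range is its set of fixed points. So
    \<open>Q A\<close> vanishes exactly when the indicator of \<open>A\<close> lies in
    \<open>c0_ideal I\<close>.\<close>
  have Q_eq_0: "Q A = 0 \<longleftrightarrow> A \<in> I" for A
  proof -
    have "Q A = 0 \<longleftrightarrow> ind_bcontfun A \<in> range P"
      unfolding Q_def by (metis P(2) eq_iff_diff_eq_0 rangeE rangeI)
    then show ?thesis by (simp add: P(3) ind_bcontfun_in_c0_ideal_iff[OF ideal])
  qed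
  have Q_Un: "Q (A \<union> B) = Q A + Q B" if "A \<inter> B = {}" for A B
    by (simp add: Q_def ind_bcontfun_Un[OF that] P.add)
  obtain K where K: "\<And>x. norm (P x) \<le> norm x * K" "K \<ge> 0"
    using P.nonneg_bounded by blast
  have Q_bound: "norm (Q A) \<le> 1 + K" for A
  proof -
    have "norm (Q A) \<le> norm (ind_bcontfun A :: nat \<Rightarrow>\<^sub>C 'a) + norm (P (ind_bcontfun A))"
      unfolding Q_def by (rule norm_triangle_ineq4)
    also have "\<dots> \<le> 1 + 1 * K"
      using norm_ind_bcontfun_le K by (intro add_mono order_trans[OF K(1)] mult_right_mono) auto
    finally show ?thesis by simp
  qed
  define \<nu> where "\<nu> n b A = apply_bcontfun (Q A) n \<bullet> b" for n b A
  \<comment> \<open>The negatives of the basis vectors are included to make \<open>M\<close> closed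
    under negation.\<close>
  define D :: "'a set" where "D = Basis \<union> uminus ` Basis"
  define M where "M = (\<lambda>(n, b). \<nu> n b) ` (UNIV \<times> D)"
  have M_I: "\<nu> n b \<in> M" if "b \<in> D" for n b
    using that by (auto simp: M_def)
  have M_null: "(\<forall>\<nu>\<in>M. \<nu> A = 0) \<longleftrightarrow> A \<in> I" for A
  proof -
    have "(\<forall>\<nu>\<in>M. \<nu> A = 0) \<longleftrightarrow> (\<forall>n. \<forall>b\<in>D. apply_bcontfun (Q A) n \<bullet> b = 0)"
      unfolding M_def \<nu>_def by force
    also have "\<dots> \<longleftrightarrow> (\<forall>n. apply_bcontfun (Q A) n = 0)"
      unfolding D_def ball_Un ball_simps inner_minus_right neg_equal_0_iff_equal
      by (simp add: euclidean_all_zero_iff)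
    also have "\<dots> \<longleftrightarrow> Q A = 0"
    proof
      assume "\<forall>n. apply_bcontfun (Q A) n = 0"
      then show "Q A = 0" by (intro bcontfun_eqI) simp
    qed simp
    finally show ?thesis using Q_eq_0 by simp
  qed
  obtain \<mu> where \<mu>: "statistical_measure \<mu>"
    "\<And>A. \<mu> A = 0 \<longleftrightarrow> (\<forall>\<nu>\<in>M. \<forall>B\<subseteq>A. \<nu> B = 0)"
  proof (rule statistical_measure_of_countable_family[of M])
    show "countable M"
      unfolding M_def D_def by (intro countable_image countable_SIGMA countable_Un) (auto intro: countable_finite)
    show "additive UNIV \<nu>'" if "\<nu>' \<in> M" for \<nu>'
      using that by (auto simp: M_def \<nu>_def additive_def Q_Un inner_add_left)
    show "bounded (range \<nu>')" if \<nu>': "\<nu>' \<in> M" for \<nu>'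
    proof -
      obtain n b where b: "\<nu>' = \<nu> n b" "b \<in> D"
        using \<nu>' by (auto simp: M_def)
      then have "norm b = 1" by (auto simp: D_def)
      then have "norm (\<nu>' A) \<le> 1 + K" for A
        using Cauchy_Schwarz_ineq2[of "apply_bcontfun (Q A) n" b] norm_bounded[of "Q A" n]
          Q_bound[of A] b(1) by (simp add: \<nu>_def)
      then show ?thesis by (auto simp: bounded_iff)
    qed
    show "(\<lambda>A. - \<nu>' A) \<in> M" if \<nu>': "\<nu>' \<in> M" for \<nu>'
    proof -
      obtain n b where b: "\<nu>' = \<nu> n b" "b \<in> D"
        using \<nu>' by (auto simp: M_def)
      then have "- b \<in> D" by (auto simp: D_def)
      moreover have "(\<lambda>A. - \<nu>' A) = \<nu> n (- b)" by (simp add: b \<nu>_def fun_eq_iff)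
      ultimately show ?thesis using M_I by simp
    qed
    show "\<nu>' {k} = 0" if "\<nu>' \<in> M" for \<nu>' k
    proof -
      have "{k} \<in> I" using ideal by (simp add: ideal_on_omega_def)
      then show ?thesis using that M_null[of "{k}"] by blast
    qed
    show "\<exists>\<nu>\<in>M. \<exists>A. \<nu> A \<noteq> 0"
    proof -
      obtain A where "A \<notin> I" using \<open>I \<noteq> UNIV\<close> by blast
      then show ?thesis using M_null[of A] by blast
    qed
  qed (rule that)
  have "\<mu> A = 0 \<longleftrightarrow> A \<in> I" for A
  proof -
    \<comment> \<open>\<open>M_null\<close> concerns values at a single set, whereas \<mu> tests all
      subsets of \<open>A\<close>. Exchanging the quantifiers reduces the test to membership of all
      these subsets in \<open>I\<close>, which downward closure of \<open>I\<close> reduces to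
      \<open>A \<in> I\<close>.\<close>
    have "\<mu> A = 0 \<longleftrightarrow> (\<forall>B\<subseteq>A. \<forall>\<nu>\<in>M. \<nu> B = 0)" unfolding \<mu>(2) by blast
    also have "\<dots> \<longleftrightarrow> (\<forall>B\<subseteq>A. B \<in> I)" unfolding M_null ..
    also have "\<dots> \<longleftrightarrow> A \<in> I"
    proof
      have down: "\<And>A B. A \<in> I \<Longrightarrow> B \<subseteq> A \<Longrightarrow> B \<in> I"
        using ideal unfolding ideal_on_omega_def by metis
      show "\<forall>B\<subseteq>A. B \<in> I" if "A \<in> I" using down[OF that] by simp
    qed simp
    finally show ?thesis .
  qed
  then have "I = {A. \<mu> A = 0}" by simp
  with \<mu>(1) ideal show ?thesis
    unfolding statistical_ideal_def by blast
qed

theorem corollary6p2: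
  fixes I :: "nat set set"
  assumes "proper_ideal I"
    and "complemented_ideal TYPE(real) I \<or> complemented_ideal TYPE(complex) I"
  shows "statistical_ideal I"
  using assms(2) by (elim disjE) (rule complemented_imp_statistical[OF assms(1)], assumption)+

end
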